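(* In an augmented virtual double category $\mathcal K$ let $f\colon A\to C$ be a vertical morphism whose companion $f_*\colon A\nrightarrow C$ exists, with defining cartesian cell $\varepsilon_f\colon f_*\Rightarrow(C)$ and corresponding weakly cocartesian cell $\eta_f\colon(A)\Rightarrow f_*$. Let $g\colon C\to A$ be a vertical morphism and consider vertical cells $\eta\colon\mathrm{id}_A\Rightarrow g\circ f$ and $\varepsilon\colon f\circ g\Rightarrow\mathrm{id}_C$, together with their factorisations through $f_*$, $$\eta=\eta'\circ\eta_f\qquad\text{and}\qquad\varepsilon=\varepsilon_f\circ\varepsilon',$$ where $\eta'\colon f_*\Rightarrow(A)$ has vertical source $\mathrm{id}_A$ and vertical target $g$, and $\varepsilon'\colon(C)\Rightarrow f_*$ has vertical source $g$ and vertical target $\mathrm{id}_C$. The following are equivalent: (a) $(\eta,\varepsilon)$ defines an adjunction $f\dashv g$ in the 2-category $V(\mathcal K)$; (b) $(\eta',\varepsilon')$ satisfies the conjoint identities $\eta'\circ\varepsilon'=\mathrm{id}_g$ and $\eta'\odot\varepsilon'=\mathrm{id}_{f_*}$, thus defining $f_*$ as the conjoint of $g$ in $\mathcal K$.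
   Context: **Augmented virtual double categories.** An augmented virtual double category $\mathcal K$ consists of: a class of objects; a category $\mathcal K_{\mathrm v}$ with these objects, whose morphisms $f\colon A\to C$ are called vertical; a directed graph $\mathcal K_{\mathrm h}$ with these objects as vertices, whose edges $J\colon A\nrightarrow B$ are called horizontal morphisms; and a class of cells. Each cell $\phi$ has a horizontal source, which is a (possibly empty) path $\underline J=(J_1,\dots,J_n)\colon A_0\nrightarrow A_n$ of horizontal morphisms; a horizontal target, which is a path $\underline K\colon C\nrightarrow D$ of length $|\underline K|\le 1$; a vertical source $f\colon A_0\to C$; and a vertical target $g\colon A_n\to D$. We write $\phi\colon\underline J\Rightarrow\underline K$. The empty path at $A$ is written $(A)$ (so $\underline K=(C)$ forces $C=D$), and $\frown$ denotes concatenation of paths. For each $n\ge 1$, each path of cells $\phi_i\colon\underline J_i\Rightarrow\underline K_i$ ($1\le i\le n$) with vertical source $f_{i-1}$ and vertical target $f_i$, and each cell $\psi\colon\underline K_1\frown\dots\frown\underline K_n\Rightarrow\underline L$ with vertical source $h$ and target $k$, there is a vertical composite $\psi\circ(\phi_1,\dots,\phi_n)\colon\underline J_1\frown\dots\frown\underline J_n\Rightarrow\underline L$ with vertical source $h\circ f_0$ and target $k\circ f_n$. There are horizontal identity cells $\mathrm{id}_J\colon J\Rightarrow J$ (with identities as vertical source and target) and vertical identity cells $\mathrm{id}_f\colon (A)\Rightarrow(C)$ for $f\colon A\to C$ (with vertical source and target $f$), with $\mathrm{id}_h\circ(\mathrm{id}_f)=\mathrm{id}_{h\circ f}$; write $\mathrm{id}_A:=\mathrm{id}_{\mathrm{id}_A}$.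 Axioms, whenever they make sense (for associativity: whenever both sides make sense): $\chi\circ(\psi_1\circ(\phi_{11},\dots,\phi_{1m_1}),\dots,\psi_n\circ(\phi_{n1},\dots,\phi_{nm_n}))=(\chi\circ(\psi_1,\dots,\psi_n))\circ(\phi_{11},\dots,\phi_{nm_n})$; $\mathrm{id}_C\circ(\phi)=\phi$; $\mathrm{id}_K\circ(\phi)=\phi$; $\phi\circ(\mathrm{id}_A)=\phi$; $\phi\circ(\mathrm{id}_{J_1},\dots,\mathrm{id}_{J_n})=\phi$; and $\psi\circ(\phi_1,\dots,\phi_i,\mathrm{id}_{f_i},\phi_{i+1},\dots,\phi_n)=\psi\circ(\phi_1,\dots,\phi_n)$ for $0\le i\le n$. A cell is vertical if both its horizontal source and target are empty. Whiskering: $h\circ\phi:=\mathrm{id}_h\circ(\phi)$ and $\psi\circ f:=\psi\circ(\mathrm{id}_f)$. Horizontal composition of cells: if $\phi\colon\underline J\Rightarrow\underline K$ and $\psi\colon\underline H\Rightarrow\underline L$ are such that the vertical target of $\phi$ is the vertical source of $\psi$ and $|\underline K|+|\underline L|\le1$, then $\phi\odot\psi:=\mathrm{id}_{\underline K\frown\underline L}\circ(\phi,\psi)\colon\underline J\frown\underline H\Rightarrow\underline K\frown\underline L$, where $\mathrm{id}_{\underline K\frown\underline L}$ is the identity cell of the single horizontal morphism in $\underline K\frown\underline L$, or $\mathrm{id}_C$ if $\underline K\frown\underline L=(C)$. $V(\mathcal K)$ is the 2-category of objects, vertical morphisms and vertical cells, where a vertical cell with vertical source $f$ and target $g$ is a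 2-cell $f\Rightarrow g$; composition of 2-cells between parallel morphisms is given by $\odot$ (in diagrammatic order) and composition along objects by $\circ$. **Cartesian and weakly cocartesian cells, companions and conjoints.** A cell $\psi\colon\underline J\Rightarrow\underline K$ with $|\underline J|\le1$, $\underline J\colon A\nrightarrow B$, vertical source $f\colon A\to C$ and target $g\colon B\to D$, is cartesian if every cell $\chi\colon\underline H\Rightarrow\underline K$, with $\underline H\colon X_0\nrightarrow X_n$ and with vertical source $f\circ h$ and target $g\circ k$ (for any $h\colon X_0\to A$, $k\colon X_n\to B$), factors as $\chi=\psi\circ\phi$ for a unique $\phi\colon\underline H\Rightarrow\underline J$ with vertical source $h$ and target $k$. A cell $\phi\colon\underline H\Rightarrow J$ with $J\colon A\nrightarrow B$, vertical source $h\colon X_0\to A$ and target $k\colon X_n\to B$, is weakly cocartesian if every $\chi\colon\underline H\Rightarrow\underline K$ with vertical source $f\circ h$ and target $g\circ k$ factors as $\chi=\psi\circ\phi$ for a unique $\psi\colon J\Rightarrow\underline K$ with vertical source $f$ and target $g$. The companion of $f\colon A\to C$ is a horizontal morphism $f_*\colon A\nrightarrow C$ with a cartesian cell $\varepsilon_f\colon f_*\Rightarrow(C)$ with vertical source $f$ and target $\mathrm{id}_C$; the corresponding weakly cocartesian cell $\eta_f\colon(A)\Rightarrow f_*$, with vertical source $\mathrm{id}_A$ and target $f$, is the unique cell with $\varepsilon_f\circ\eta_f=\mathrm{id}_f$; it also satisfies $\eta_f\odot\varepsilon_f=\mathrm{id}_{f_*}$. The conjoint of $g\colon C\to A$ is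 a horizontal morphism $g^*\colon A\nrightarrow C$ with a cartesian cell $g^*\Rightarrow(A)$ with vertical source $\mathrm{id}_A$ and target $g$. *)

theory Defs
  imports Main
begin

section \<open>Categories and 2-categories\<close>

text \<open>Composition is in the order of function composition:
  \<open>cmp C h f\<close> is \<open>h\<close> after \<open>f\<close>.\<close>

record ('o, 'v) cat =
  obj :: "'o set"
  arr :: "'v set"
  src :: "'v \<Rightarrow> 'o"
  tgt :: "'v \<Rightarrow> 'o"
  idn :: "'o \<Rightarrow> 'v"
  cmp :: "'v \<Rightarrow> 'v \<Rightarrow> 'v"

definition arr_in :: "('o, 'v, 'm) cat_scheme \<Rightarrow> 'v \<Rightarrow> 'o \<Rightarrow> 'o \<Rightarrow> bool" where
  "arr_in C f a b \<longleftrightarrow> f \<in> arr C \<and> src C f = a \<and> tgt C f = b"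

locale category =
  fixes C :: "('o, 'v, 'm) cat_scheme"
  assumes src_obj: "f \<in> arr C \<Longrightarrow> src C f \<in> obj C"
    and tgt_obj: "f \<in> arr C \<Longrightarrow> tgt C f \<in> obj C"
    and idn_in: "a \<in> obj C \<Longrightarrow> arr_in C (idn C a) a a"
    and cmp_in: "\<lbrakk>arr_in C f a b; arr_in C h b c\<rbrakk> \<Longrightarrow> arr_in C (cmp C h f) a c"
    and cmp_idn_left: "arr_in C f a b \<Longrightarrow> cmp C (idn C b) f = f"
    and cmp_idn_right: "arr_in C f a b \<Longrightarrow> cmp C f (idn C a) = f"
    and cmp_assoc: "\<lbrakk>arr_in C f a b; arr_in C g b c; arr_in C h c d\<rbrakk>
      \<Longrightarrow> cmp C h (cmp C g f) = cmp C (cmp C h g) f"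

text \<open>\<open>par2 T \<alpha> \<beta>\<close> composes 2-cells between parallel morphisms, in diagrammatic order
  (first \<open>\<alpha>\<close>, then \<open>\<beta>\<close>); \<open>obj2 T \<beta> \<alpha>\<close> composes along objects, in the order of
  \<open>cmp\<close>.\<close>

record ('o, 'v, 'c) two_cat = "('o, 'v) cat" +
  cell2 :: "'c set"
  src2 :: "'c \<Rightarrow> 'v"
  tgt2 :: "'c \<Rightarrow> 'v"
  id2 :: "'v \<Rightarrow> 'c"
  par2 :: "'c \<Rightarrow> 'c \<Rightarrow> 'c"
  obj2 :: "'c \<Rightarrow> 'c \<Rightarrow> 'c"

definition cell2_in :: "('o, 'v, 'c, 'm) two_cat_scheme \<Rightarrow> 'c \<Rightarrow> 'v \<Rightarrow> 'v \<Rightarrow> bool" where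
  "cell2_in T \<alpha> f g \<longleftrightarrow> \<alpha> \<in> cell2 T \<and> src2 T \<alpha> = f \<and> tgt2 T \<alpha> = g"

locale two_category = category T for T :: "('o, 'v, 'c, 'm) two_cat_scheme" +
  assumes cell2_boundary: "cell2_in T \<alpha> f g
      \<Longrightarrow> f \<in> arr T \<and> g \<in> arr T \<and> src T f = src T g \<and> tgt T f = tgt T g"
    and id2_in: "f \<in> arr T \<Longrightarrow> cell2_in T (id2 T f) f f"
    and par2_in: "\<lbrakk>cell2_in T \<alpha> f g; cell2_in T \<beta> g h\<rbrakk> \<Longrightarrow> cell2_in T (par2 T \<alpha> \<beta>) f h"
    and par2_id_left: "cell2_in T \<alpha> f g \<Longrightarrow> par2 T (id2 T f) \<alpha> = \<alpha>"
    and par2_id_right: "cell2_in T \<alpha> f g \<Longrightarrow> par2 T \<alpha> (id2 T g) = \<alpha>"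
    and par2_assoc: "\<lbrakk>cell2_in T \<alpha> f g; cell2_in T \<beta> g h; cell2_in T \<gamma> h k\<rbrakk>
      \<Longrightarrow> par2 T (par2 T \<alpha> \<beta>) \<gamma> = par2 T \<alpha> (par2 T \<beta> \<gamma>)"
    and obj2_in: "\<lbrakk>cell2_in T \<alpha> f g; cell2_in T \<beta> h k; tgt T f = src T h\<rbrakk>
      \<Longrightarrow> cell2_in T (obj2 T \<beta> \<alpha>) (cmp T h f) (cmp T k g)"
    and obj2_id_left: "cell2_in T \<alpha> f g \<Longrightarrow> obj2 T (id2 T (idn T (tgt T f))) \<alpha> = \<alpha>"
    and obj2_id_right: "cell2_in T \<alpha> f g \<Longrightarrow> obj2 T \<alpha> (id2 T (idn T (src T f))) = \<alpha>"
    and obj2_assoc: "\<lbrakk>cell2_in T \<alpha> f f'; cell2_in T \<beta> g g'; cell2_in T \<gamma> h h';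
        tgt T f = src T g; tgt T g = src T h\<rbrakk>
      \<Longrightarrow> obj2 T \<gamma> (obj2 T \<beta> \<alpha>) = obj2 T (obj2 T \<gamma> \<beta>) \<alpha>"
    and obj2_id2: "\<lbrakk>f \<in> arr T; h \<in> arr T; tgt T f = src T h\<rbrakk>
      \<Longrightarrow> obj2 T (id2 T h) (id2 T f) = id2 T (cmp T h f)"
    and interchange: "\<lbrakk>cell2_in T \<alpha> f f'; cell2_in T \<alpha>' f' f''; cell2_in T \<beta> h h';
        cell2_in T \<beta>' h' h''; tgt T f = src T h\<rbrakk>
      \<Longrightarrow> obj2 T (par2 T \<beta> \<beta>') (par2 T \<alpha> \<alpha>') = par2 T (obj2 T \<beta> \<alpha>) (obj2 T \<beta>' \<alpha>')"

definition adjunction_in :: "('o, 'v, 'c, 'm) two_cat_scheme \<Rightarrow> 'v \<Rightarrow> 'v \<Rightarrow> 'c \<Rightarrow> 'c \<Rightarrow> bool" where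
  "adjunction_in T f g \<eta> \<epsilon> \<longleftrightarrow>
    (\<exists>a c. arr_in T f a c \<and> arr_in T g c a \<and>
      cell2_in T \<eta> (idn T a) (cmp T g f) \<and> cell2_in T \<epsilon> (cmp T f g) (idn T c) \<and>
      par2 T (obj2 T (id2 T f) \<eta>) (obj2 T \<epsilon> (id2 T f)) = id2 T f \<and>
      par2 T (obj2 T \<eta> (id2 T g)) (obj2 T (id2 T g) \<epsilon>) = id2 T g)"


section \<open>Augmented virtual double categories\<close>

text \<open>The inherited fields form the vertical category. The horizontal source and target of a cell
  are recorded as lists; the base object of an empty path is not stored but is determined by the
  vertical boundary (see \<open>cell_paths\<close> below).\<close>

record ('o, 'v, 'h, 'c) avdc = "('o, 'v) cat" +
  hmor :: "'h set"
  hdom :: "'h \<Rightarrow> 'o"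
  hcod :: "'h \<Rightarrow> 'o"
  cell :: "'c set"
  hsrc :: "'c \<Rightarrow> 'h list"
  htgt :: "'c \<Rightarrow> 'h list"
  vsrc :: "'c \<Rightarrow> 'v"
  vtgt :: "'c \<Rightarrow> 'v"
  vcomp :: "'c \<Rightarrow> 'c list \<Rightarrow> 'c"
  idh :: "'h \<Rightarrow> 'c"
  idv :: "'v \<Rightarrow> 'c"

fun hpath :: "('o, 'v, 'h, 'c, 'm) avdc_scheme \<Rightarrow> 'o \<Rightarrow> 'h list \<Rightarrow> 'o \<Rightarrow> bool" where
  "hpath K a [] b \<longleftrightarrow> a \<in> obj K \<and> a = b"
| "hpath K a (J # Js) b \<longleftrightarrow> J \<in> hmor K \<and> hdom K J = a \<and> hpath K (hcod K J) Js b"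

definition cell_in ::
  "('o, 'v, 'h, 'c, 'm) avdc_scheme \<Rightarrow> 'c \<Rightarrow> 'h list \<Rightarrow> 'h list \<Rightarrow> 'v \<Rightarrow> 'v \<Rightarrow> bool" where
  "cell_in K \<phi> Js Ks f g \<longleftrightarrow>
    \<phi> \<in> cell K \<and> hsrc K \<phi> = Js \<and> htgt K \<phi> = Ks \<and> vsrc K \<phi> = f \<and> vtgt K \<phi> = g"

text \<open>\<open>composable K \<psi> \<phi>s\<close> says that the vertical composite of \<open>\<psi>\<close> with the nonempty path of
  cells \<open>\<phi>s\<close> is defined. The last condition locates the path \<open>hsrc K \<psi>\<close> at the target of
  the first vertical boundary; it is needed when that path is empty.\<close>

definition composable :: "('o, 'v, 'h, 'c, 'm) avdc_scheme \<Rightarrow> 'c \<Rightarrow> 'c list \<Rightarrow> bool" where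
  "composable K \<psi> \<phi>s \<longleftrightarrow>
    \<psi> \<in> cell K \<and> \<phi>s \<noteq> [] \<and> set \<phi>s \<subseteq> cell K \<and>
    successively (\<lambda>\<phi> \<phi>'. vtgt K \<phi> = vsrc K \<phi>') \<phi>s \<and>
    hsrc K \<psi> = concat (map (htgt K) \<phi>s) \<and>
    src K (vsrc K \<psi>) = tgt K (vsrc K (hd \<phi>s))"

locale augmented_virtual_double_category = category K
  for K :: "('o, 'v, 'h, 'c, 'm) avdc_scheme" +
  assumes hdom_obj: "J \<in> hmor K \<Longrightarrow> hdom K J \<in> obj K"
    and hcod_obj: "J \<in> hmor K \<Longrightarrow> hcod K J \<in> obj K"
    and cell_arr: "\<phi> \<in> cell K \<Longrightarrow> vsrc K \<phi> \<in> arr K \<and> vtgt K \<phi> \<in> arr K"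
    and cell_paths: "\<phi> \<in> cell K \<Longrightarrow>
        hpath K (src K (vsrc K \<phi>)) (hsrc K \<phi>) (src K (vtgt K \<phi>)) \<and>
        hpath K (tgt K (vsrc K \<phi>)) (htgt K \<phi>) (tgt K (vtgt K \<phi>))"
    and htgt_length: "\<phi> \<in> cell K \<Longrightarrow> length (htgt K \<phi>) \<le> 1"
    and vcomp_in: "composable K \<psi> \<phi>s \<Longrightarrow>
        cell_in K (vcomp K \<psi> \<phi>s) (concat (map (hsrc K) \<phi>s)) (htgt K \<psi>)
          (cmp K (vsrc K \<psi>) (vsrc K (hd \<phi>s))) (cmp K (vtgt K \<psi>) (vtgt K (last \<phi>s)))"
    and idh_in: "J \<in> hmor K \<Longrightarrow>
        cell_in K (idh K J) [J] [J] (idn K (hdom K J)) (idn K (hcod K J))"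
    and idv_in: "f \<in> arr K \<Longrightarrow> cell_in K (idv K f) [] [] f f"
    and vcomp_idv_idv: "\<lbrakk>f \<in> arr K; h \<in> arr K; src K h = tgt K f\<rbrakk> \<Longrightarrow>
        vcomp K (idv K h) [idv K f] = idv K (cmp K h f)"
    and vcomp_assoc: "\<lbrakk>list_all2 (composable K) \<psi>s \<phi>ss; composable K \<chi> \<psi>s;
        composable K \<chi> (map2 (vcomp K) \<psi>s \<phi>ss);
        composable K (vcomp K \<chi> \<psi>s) (concat \<phi>ss)\<rbrakk> \<Longrightarrow>
        vcomp K \<chi> (map2 (vcomp K) \<psi>s \<phi>ss) = vcomp K (vcomp K \<chi> \<psi>s) (concat \<phi>ss)"
    and vcomp_idn_left: "\<lbrakk>c \<in> obj K; composable K (idv K (idn K c)) [\<phi>]\<rbrakk> \<Longrightarrow>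
        vcomp K (idv K (idn K c)) [\<phi>] = \<phi>"
    and vcomp_idh_left: "\<lbrakk>J \<in> hmor K; composable K (idh K J) [\<phi>]\<rbrakk> \<Longrightarrow>
        vcomp K (idh K J) [\<phi>] = \<phi>"
    and vcomp_idn_right: "\<lbrakk>a \<in> obj K; composable K \<phi> [idv K (idn K a)]\<rbrakk> \<Longrightarrow>
        vcomp K \<phi> [idv K (idn K a)] = \<phi>"
    and vcomp_idh_right: "\<lbrakk>set Js \<subseteq> hmor K; composable K \<phi> (map (idh K) Js)\<rbrakk> \<Longrightarrow>
        vcomp K \<phi> (map (idh K) Js) = \<phi>"
    and vcomp_insert_idv: "\<lbrakk>f \<in> arr K; composable K \<psi> (\<phi>s @ \<phi>s');
        composable K \<psi> (\<phi>s @ [idv K f] @ \<phi>s')\<rbrakk> \<Longrightarrow>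
        vcomp K \<psi> (\<phi>s @ [idv K f] @ \<phi>s') = vcomp K \<psi> (\<phi>s @ \<phi>s')"

text \<open>The identity cell of a path of length at most 1 based at \<open>c\<close>; longer lists do not occur.\<close>

fun idpath :: "('o, 'v, 'h, 'c, 'm) avdc_scheme \<Rightarrow> 'o \<Rightarrow> 'h list \<Rightarrow> 'c" where
  "idpath K c [] = idv K (idn K c)"
| "idpath K c (J # Js) = idh K J"

definition hcomp :: "('o, 'v, 'h, 'c, 'm) avdc_scheme \<Rightarrow> 'c \<Rightarrow> 'c \<Rightarrow> 'c" where
  "hcomp K \<phi> \<psi> =
    vcomp K (idpath K (tgt K (vsrc K \<phi>)) (htgt K \<phi> @ htgt K \<psi>)) [\<phi>, \<psi>]"

definition vertical_two_cat ::
  "('o, 'v, 'h, 'c, 'm) avdc_scheme \<Rightarrow> ('o, 'v, 'c) two_cat" where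
  "vertical_two_cat K =
    \<lparr> obj = obj K, arr = arr K, src = src K, tgt = tgt K, idn = idn K, cmp = cmp K,
      cell2 = {\<phi> \<in> cell K. hsrc K \<phi> = [] \<and> htgt K \<phi> = []},
      src2 = vsrc K, tgt2 = vtgt K, id2 = idv K,
      par2 = hcomp K, obj2 = (\<lambda>\<psi> \<phi>. vcomp K \<psi> [\<phi>]) \<rparr>"


section \<open>Cartesian cells, companions and conjoints\<close>

definition cartesian :: "('o, 'v, 'h, 'c, 'm) avdc_scheme \<Rightarrow> 'c \<Rightarrow> bool" where
  "cartesian K \<psi> \<longleftrightarrow> \<psi> \<in> cell K \<and> length (hsrc K \<psi>) \<le> 1 \<and>
    (\<forall>\<chi> Hs h k. h \<in> arr K \<and> k \<in> arr K \<and>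
        tgt K h = src K (vsrc K \<psi>) \<and> tgt K k = src K (vtgt K \<psi>) \<and>
        cell_in K \<chi> Hs (htgt K \<psi>) (cmp K (vsrc K \<psi>) h) (cmp K (vtgt K \<psi>) k) \<longrightarrow>
      (\<exists>!\<phi>. cell_in K \<phi> Hs (hsrc K \<psi>) h k \<and> \<chi> = vcomp K \<psi> [\<phi>]))"

definition weakly_cocartesian :: "('o, 'v, 'h, 'c, 'm) avdc_scheme \<Rightarrow> 'c \<Rightarrow> bool" where
  "weakly_cocartesian K \<phi> \<longleftrightarrow> \<phi> \<in> cell K \<and> length (htgt K \<phi>) = 1 \<and>
    (\<forall>\<chi> Ks f g. f \<in> arr K \<and> g \<in> arr K \<and>
        src K f = tgt K (vsrc K \<phi>) \<and> src K g = tgt K (vtgt K \<phi>) \<and>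
        cell_in K \<chi> (hsrc K \<phi>) Ks (cmp K f (vsrc K \<phi>)) (cmp K g (vtgt K \<phi>)) \<longrightarrow>
      (\<exists>!\<psi>. cell_in K \<psi> (htgt K \<phi>) Ks f g \<and> \<chi> = vcomp K \<psi> [\<phi>]))"

definition companion :: "('o, 'v, 'h, 'c, 'm) avdc_scheme \<Rightarrow> 'v \<Rightarrow> 'h \<Rightarrow> 'c \<Rightarrow> bool" where
  "companion K f J \<epsilon> \<longleftrightarrow>
    f \<in> arr K \<and> J \<in> hmor K \<and> hdom K J = src K f \<and> hcod K J = tgt K f \<and>
    cell_in K \<epsilon> [J] [] f (idn K (tgt K f)) \<and> cartesian K \<epsilon>"

text \<open>For a companion \<open>J\<close> of \<open>f\<close> with cartesian cell \<open>\<epsilon>\<close>, there is exactly one such \<open>\<eta>\<close>, and it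
  is weakly cocartesian (lemmas \<open>companion_unit_ex1\<close>, \<open>companion_unit_weakly_cocartesian\<close>).\<close>

definition companion_unit ::
  "('o, 'v, 'h, 'c, 'm) avdc_scheme \<Rightarrow> 'v \<Rightarrow> 'h \<Rightarrow> 'c \<Rightarrow> 'c \<Rightarrow> bool" where
  "companion_unit K f J \<epsilon> \<eta> \<longleftrightarrow>
    cell_in K \<eta> [] [J] (idn K (src K f)) f \<and> vcomp K \<epsilon> [\<eta>] = idv K f"

definition conjoint :: "('o, 'v, 'h, 'c, 'm) avdc_scheme \<Rightarrow> 'v \<Rightarrow> 'h \<Rightarrow> 'c \<Rightarrow> bool" where
  "conjoint K g J \<epsilon> \<longleftrightarrow>
    g \<in> arr K \<and> J \<in> hmor K \<and> hdom K J = tgt K g \<and> hcod K J = src K g \<and>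
    cell_in K \<epsilon> [J] [] (idn K (tgt K g)) g \<and> cartesian K \<epsilon>"


section \<open>Consistency of the definitions\<close>

context augmented_virtual_double_category
begin

lemma cell_in_arr:
  assumes "cell_in K \<phi> Js Ks f g"
  shows "f \<in> arr K" "g \<in> arr K" "hpath K (src K f) Js (src K g)"
    "hpath K (tgt K f) Ks (tgt K g)" "\<phi> \<in> cell K"
  using assms cell_arr cell_paths unfolding cell_in_def by blast+

lemma cell_in_ends:
  "cell_in K \<phi> [] Ks f g \<Longrightarrow> src K g = src K f"
  "cell_in K \<phi> Js [] f g \<Longrightarrow> tgt K g = tgt K f"
  using cell_in_arr(3,4) by fastforce+

lemma composable1:
  assumes "cell_in K \<psi> Ks Ls h k" "cell_in K \<phi> Js Ks f g" "tgt K f = src K h"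
  shows "composable K \<psi> [\<phi>]"
  using assms unfolding composable_def cell_in_def by simp

lemma composable2:
  assumes "cell_in K \<psi> (Ks @ Ks') Ls h k" "cell_in K \<phi> Js Ks f g" "cell_in K \<phi>' Js' Ks' g g'"
    "tgt K f = src K h"
  shows "composable K \<psi> [\<phi>, \<phi>']"
  using assms unfolding composable_def cell_in_def by simp

lemma vcomp1_in:
  assumes "cell_in K \<psi> Ks Ls h k" "cell_in K \<phi> Js Ks f g" "tgt K f = src K h"
  shows "cell_in K (vcomp K \<psi> [\<phi>]) Js Ls (cmp K h f) (cmp K k g)"
  using vcomp_in[OF composable1[OF assms]] assms unfolding cell_in_def by simp

lemma vcomp2_in:
  assumes "cell_in K \<psi> (Ks @ Ks') Ls h k" "cell_in K \<phi> Js Ks f g" "cell_in K \<phi>' Js' Ks' g g'"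
    "tgt K f = src K h"
  shows "cell_in K (vcomp K \<psi> [\<phi>, \<phi>']) (Js @ Js') Ls (cmp K h f) (cmp K k g')"
  using vcomp_in[OF composable2[OF assms]] assms unfolding cell_in_def by simp

lemma arr_idn: "a \<in> obj K \<Longrightarrow> idn K a \<in> arr K" "a \<in> obj K \<Longrightarrow> src K (idn K a) = a"
  "a \<in> obj K \<Longrightarrow> tgt K (idn K a) = a"
  using idn_in unfolding arr_in_def by auto

lemma arr_cmp:
  assumes "f \<in> arr K" "h \<in> arr K" "tgt K f = src K h"
  shows "cmp K h f \<in> arr K" "src K (cmp K h f) = src K f" "tgt K (cmp K h f) = tgt K h"
proof -
  have "arr_in K f (src K f) (src K h)" "arr_in K h (src K h) (tgt K h)"
    using assms unfolding arr_in_def by simp_all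
  from cmp_in[OF this]
  show "cmp K h f \<in> arr K" "src K (cmp K h f) = src K f" "tgt K (cmp K h f) = tgt K h"
    unfolding arr_in_def by simp_all
qed

lemma cmp_idn:
  assumes "f \<in> arr K"
  shows "cmp K (idn K (tgt K f)) f = f" "cmp K f (idn K (src K f)) = f"
proof -
  have "arr_in K f (src K f) (tgt K f)" using assms unfolding arr_in_def by simp
  from cmp_idn_left[OF this] cmp_idn_right[OF this]
  show "cmp K (idn K (tgt K f)) f = f" "cmp K f (idn K (src K f)) = f" .
qed

lemma idn_cell: "a \<in> obj K \<Longrightarrow> cell_in K (idv K (idn K a)) [] [] (idn K a) (idn K a)"
  using idv_in arr_idn by blast

lemma vcomp_assoc11:
  assumes \<chi>: "cell_in K \<chi> Ks Ls p q" and \<psi>: "cell_in K \<psi> Js Ks h k"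
    and \<phi>: "cell_in K \<phi> Hs Js f g" and e: "tgt K f = src K h" "tgt K h = src K p"
  shows "vcomp K \<chi> [vcomp K \<psi> [\<phi>]] = vcomp K (vcomp K \<chi> [\<psi>]) [\<phi>]"
proof -
  have h: "h \<in> arr K" "p \<in> arr K" "f \<in> arr K"
    using cell_in_arr \<chi> \<psi> \<phi> by auto
  note 1 = vcomp1_in[OF \<psi> \<phi> e(1)] and 2 = vcomp1_in[OF \<chi> \<psi> e(2)]
  have "composable K \<chi> [vcomp K \<psi> [\<phi>]]"
    by (rule composable1[OF \<chi> 1]) (use h e arr_cmp in simp)
  moreover have "composable K (vcomp K \<chi> [\<psi>]) [\<phi>]"
    by (rule composable1[OF 2 \<phi>]) (use h e arr_cmp in simp)
  ultimately show ?thesis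
    using vcomp_assoc[of "[\<psi>]" "[[\<phi>]]" \<chi>] composable1[OF \<psi> \<phi> e(1)] composable1[OF \<chi> \<psi> e(2)]
    by simp
qed

lemma vcomp_assoc12:
  assumes \<chi>: "cell_in K \<chi> Ks Ls p q" and \<psi>: "cell_in K \<psi> (Js @ Js') Ks h k"
    and \<phi>: "cell_in K \<phi> Hs Js f g" and \<phi>': "cell_in K \<phi>' Hs' Js' g g'"
    and e: "tgt K f = src K h" "tgt K h = src K p"
  shows "vcomp K \<chi> [vcomp K \<psi> [\<phi>, \<phi>']] = vcomp K (vcomp K \<chi> [\<psi>]) [\<phi>, \<phi>']"
proof -
  have h: "h \<in> arr K" "p \<in> arr K" "f \<in> arr K"
    using cell_in_arr \<chi> \<psi> \<phi> by auto
  note 1 = vcomp2_in[OF \<psi> \<phi> \<phi>' e(1)] and 2 = vcomp1_in[OF \<chi> \<psi> e(2)]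
  have "composable K \<chi> [vcomp K \<psi> [\<phi>, \<phi>']]"
    by (rule composable1[OF \<chi> 1]) (use h e arr_cmp in simp)
  moreover have "composable K (vcomp K \<chi> [\<psi>]) [\<phi>, \<phi>']"
    by (rule composable2[OF 2 \<phi> \<phi>']) (use h e arr_cmp in simp)
  ultimately show ?thesis
    using vcomp_assoc[of "[\<psi>]" "[[\<phi>, \<phi>']]" \<chi>] composable2[OF \<psi> \<phi> \<phi>' e(1)]
      composable1[OF \<chi> \<psi> e(2)]
    by simp
qed

lemma vcomp_assoc2:
  assumes \<chi>: "cell_in K \<chi> (Ks @ Ks') Ls p q"
    and \<psi>: "cell_in K \<psi> Js Ks h k" and \<psi>': "cell_in K \<psi>' Js' Ks' k k'"
    and \<phi>: "cell_in K \<phi> Hs Js f g" and \<phi>': "cell_in K \<phi>' Hs' Js' g g'"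
    and e: "tgt K f = src K h" "tgt K g = src K k" "tgt K h = src K p"
  shows "vcomp K \<chi> [vcomp K \<psi> [\<phi>], vcomp K \<psi>' [\<phi>']] = vcomp K (vcomp K \<chi> [\<psi>, \<psi>']) [\<phi>, \<phi>']"
proof -
  have h: "h \<in> arr K" "p \<in> arr K" "f \<in> arr K"
    using cell_in_arr \<chi> \<psi> \<phi> by auto
  note 1 = vcomp1_in[OF \<psi> \<phi> e(1)] and 3 = vcomp1_in[OF \<psi>' \<phi>' e(2)]
    and 2 = vcomp2_in[OF \<chi> \<psi> \<psi>' e(3)]
  have "composable K \<chi> [vcomp K \<psi> [\<phi>], vcomp K \<psi>' [\<phi>']]"
    by (rule composable2[OF \<chi> 1 3]) (use h e arr_cmp in simp)
  moreover have "composable K (vcomp K \<chi> [\<psi>, \<psi>']) [\<phi>, \<phi>']"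
    by (rule composable2[OF 2 \<phi> \<phi>']) (use h e arr_cmp in simp)
  ultimately show ?thesis
    using vcomp_assoc[of "[\<psi>, \<psi>']" "[[\<phi>], [\<phi>']]" \<chi>] composable1[OF \<psi> \<phi> e(1)]
      composable1[OF \<psi>' \<phi>' e(2)] composable2[OF \<chi> \<psi> \<psi>' e(3)]
    by simp
qed

lemma idn_vcomp:
  assumes "cell_in K \<phi> Js [] f g" "c = tgt K f"
  shows "vcomp K (idv K (idn K c)) [\<phi>] = \<phi>"
proof -
  have "c \<in> obj K" using assms cell_in_arr(1) tgt_obj by metis
  then show ?thesis
    using vcomp_idn_left composable1[OF idn_cell assms(1)] arr_idn assms(2) by metis
qed

lemma vcomp_idn:
  assumes "cell_in K \<phi> [] Ks f g" "a = src K f"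
  shows "vcomp K \<phi> [idv K (idn K a)] = \<phi>"
proof -
  have "a \<in> obj K" using assms cell_in_arr(1) src_obj by metis
  then show ?thesis
    using vcomp_idn_right composable1[OF assms(1) idn_cell] arr_idn assms(2) by metis
qed

lemma idh_vcomp:
  assumes "cell_in K \<phi> Js [J] f g"
  shows "vcomp K (idh K J) [\<phi>] = \<phi>"
proof -
  have J: "J \<in> hmor K" "hdom K J = tgt K f" using cell_in_arr(4)[OF assms] by auto
  then show ?thesis
    using vcomp_idh_left composable1[OF idh_in assms] arr_idn hdom_obj by metis
qed

lemma vcomp_idh:
  assumes "cell_in K \<phi> [J] Ks f g"
  shows "vcomp K \<phi> [idh K J] = \<phi>"
proof -
  have J: "J \<in> hmor K" "hdom K J = src K f" using cell_in_arr(3)[OF assms] by auto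
  then have "composable K \<phi> [idh K J]"
    using composable1[OF assms idh_in] arr_idn hdom_obj by metis
  then show ?thesis using vcomp_idh_right[of "[J]" \<phi>] J by simp
qed

lemma vcomp_idv_pair:
  assumes "cell_in K \<psi> Ks Ls h k" "cell_in K \<phi> Js Ks f g" "tgt K f = src K h"
  shows "tgt K g = src K k"
    and "vcomp K \<psi> [idv K f, \<phi>] = vcomp K \<psi> [\<phi>]"
    and "vcomp K \<psi> [\<phi>, idv K g] = vcomp K \<psi> [\<phi>]"
proof -
  have path_end: "b = b'" if "hpath K a Is b" "hpath K a Is b'" for a b b' Is
    using that by (induction Is arbitrary: a) auto
  show "tgt K g = src K k"
    using path_end cell_in_arr(3)[OF assms(1)] cell_in_arr(4)[OF assms(2)] assms(3) by metis
  have f: "f \<in> arr K" "g \<in> arr K" using cell_in_arr assms(2) by blast+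
  have "composable K \<psi> [idv K f, \<phi>]"
    by (rule composable2[of \<psi> "[]" Ks]) (use assms f idv_in in auto)
  then show "vcomp K \<psi> [idv K f, \<phi>] = vcomp K \<psi> [\<phi>]"
    using vcomp_insert_idv[of f \<psi> "[]" "[\<phi>]"] f composable1[OF assms] by simp
  have "composable K \<psi> [\<phi>, idv K g]"
    by (rule composable2[of \<psi> Ks "[]"]) (use assms f idv_in in auto)
  then show "vcomp K \<psi> [\<phi>, idv K g] = vcomp K \<psi> [\<phi>]"
    using vcomp_insert_idv[of g \<psi> "[\<phi>]" "[]"] f composable1[OF assms] by simp
qed

lemma hcomp_eq:
  assumes "cell_in K \<phi> Js [] f g" "cell_in K \<psi> Hs [] g h" "c = tgt K f"
  shows "hcomp K \<phi> \<psi> = vcomp K (idv K (idn K c)) [\<phi>, \<psi>]"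
  using assms unfolding hcomp_def cell_in_def by simp

lemma hcomp_eq_idh:
  assumes "cell_in K \<phi> Js Ks f g" "cell_in K \<psi> Hs Ls g h" "Ks @ Ls = [L]"
  shows "hcomp K \<phi> \<psi> = vcomp K (idh K L) [\<phi>, \<psi>]"
  using assms unfolding hcomp_def cell_in_def by simp

lemma hcomp_in:
  assumes "cell_in K \<phi> Js [] f g" "cell_in K \<psi> Hs [] g h"
  shows "cell_in K (hcomp K \<phi> \<psi>) (Js @ Hs) [] f h"
proof -
  let ?c = "tgt K f"
  have f: "f \<in> arr K" "h \<in> arr K" "?c \<in> obj K" "tgt K h = ?c"
    using cell_in_arr assms tgt_obj cell_in_ends(2)[OF assms(1)] cell_in_ends(2)[OF assms(2)]
    by simp_all
  show ?thesis
    using vcomp2_in[of "idv K (idn K ?c)" "[]" "[]", OF _ assms] idn_cell[OF f(3)]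
      hcomp_eq[OF assms refl] cmp_idn f arr_idn
    by (metis append_Nil)
qed

lemma hcomp_assoc:
  assumes \<phi>: "cell_in K \<phi> Js [] f g" and \<psi>: "cell_in K \<psi> Js' [] g h"
    and \<chi>: "cell_in K \<chi> Js'' [] h k"
  shows "hcomp K (hcomp K \<phi> \<psi>) \<chi> = hcomp K \<phi> (hcomp K \<psi> \<chi>)"
proof -
  let ?c = "tgt K f" let ?i = "idv K (idn K ?c)"
  have c: "?c \<in> obj K" "tgt K g = ?c" "tgt K h = ?c"
    using cell_in_arr assms tgt_obj cell_in_ends(2)[OF \<phi>] cell_in_ends(2)[OF \<psi>]
    by simp_all
  note i = idn_cell[OF c(1)]
  note si = arr_idn(2,3)[OF c(1)] and cs = \<phi>[unfolded cell_in_def] \<psi>[unfolded cell_in_def]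
    \<chi>[unfolded cell_in_def] i[unfolded cell_in_def]
  note e = hcomp_eq[OF \<phi> \<psi> refl] hcomp_eq[OF \<psi> \<chi> c(2)[symmetric]]
  note t = hcomp_in[OF \<phi> \<psi>] hcomp_in[OF \<psi> \<chi>]
  have ii: "vcomp K ?i [?i, ?i] = ?i"
    using vcomp_idv_pair(2)[OF i i] idn_vcomp[OF i] si by simp
  have ci: "composable K ?i [?i, ?i]" "composable K ?i [\<phi>]" "composable K ?i [\<chi>]"
    "composable K ?i [\<phi>, \<psi>]" "composable K ?i [\<psi>, \<chi>]" "composable K ?i [\<phi>, \<psi>, \<chi>]"
    using cs si c unfolding composable_def by simp_all
  have cl: "composable K ?i [hcomp K \<phi> \<psi>, \<chi>]" "composable K ?i [\<phi>, hcomp K \<psi> \<chi>]"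
    using cs si c t unfolding composable_def by (simp_all add: cell_in_def)
  have "hcomp K (hcomp K \<phi> \<psi>) \<chi> = vcomp K ?i [\<phi>, \<psi>, \<chi>]"
    using vcomp_assoc[of "[?i, ?i]" "[[\<phi>, \<psi>], [\<chi>]]" ?i] ci cl ii e
      idn_vcomp[OF \<chi> c(3)[symmetric]] hcomp_eq[OF t(1) \<chi> refl] by simp
  moreover have "hcomp K \<phi> (hcomp K \<psi> \<chi>) = vcomp K ?i [\<phi>, \<psi>, \<chi>]"
    using vcomp_assoc[of "[?i, ?i]" "[[\<phi>], [\<psi>, \<chi>]]" ?i] ci cl ii e
      idn_vcomp[OF \<phi> refl] hcomp_eq[OF \<phi> t(2) refl] by simp
  ultimately show ?thesis by simp
qed

lemma hcomp_interchange:
  assumes \<phi>: "cell_in K \<phi> [] [] f f'" and \<phi>': "cell_in K \<phi>' [] [] f' f''"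
    and \<psi>: "cell_in K \<psi> [] [] h h'" and \<psi>': "cell_in K \<psi>' [] [] h' h''"
    and e: "tgt K f = src K h"
  shows "vcomp K (hcomp K \<psi> \<psi>') [hcomp K \<phi> \<phi>'] = hcomp K (vcomp K \<psi> [\<phi>]) (vcomp K \<psi>' [\<phi>'])"
proof -
  let ?c = "tgt K f" and ?d = "tgt K h"
  have a: "f \<in> arr K" "f' \<in> arr K" "h \<in> arr K" "h' \<in> arr K" "?c \<in> obj K" "?d \<in> obj K"
    using cell_in_arr \<phi> \<phi>' \<psi> \<psi>' tgt_obj by simp_all
  have e': "tgt K f' = src K h'"
    using cell_in_ends(1)[OF \<psi>] cell_in_ends(2)[OF \<phi>] e by simp
  note t = vcomp1_in[OF \<psi> \<phi> e] vcomp1_in[OF \<psi>' \<phi>' e']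
  note H = hcomp_in[OF \<psi> \<psi>', simplified]
  have "vcomp K (hcomp K \<psi> \<psi>') [hcomp K \<phi> \<phi>']
      = vcomp K (vcomp K (hcomp K \<psi> \<psi>') [idv K (idn K ?c)]) [\<phi>, \<phi>']"
    unfolding hcomp_eq[OF \<phi> \<phi>' refl]
    using vcomp_assoc12[of "hcomp K \<psi> \<psi>'" "[]" _ _ _ _ "[]" "[]", OF H _ \<phi> \<phi>']
      idn_cell[OF a(5)] arr_idn a e by simp
  also have "\<dots> = vcomp K (hcomp K \<psi> \<psi>') [\<phi>, \<phi>']"
    using vcomp_idn[OF H e] by simp
  also have "\<dots> = hcomp K (vcomp K \<psi> [\<phi>]) (vcomp K \<psi>' [\<phi>'])"
    unfolding hcomp_eq[OF \<psi> \<psi>' refl]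
    using vcomp_assoc2[of "idv K (idn K ?d)" "[]" "[]" "[]" "idn K ?d" "idn K ?d",
        OF _ \<psi> \<psi>' \<phi> \<phi>' e e']
      hcomp_eq[OF t refl] idn_cell[OF a(6)] arr_idn(2)[OF a(6)] arr_cmp(3)[OF a(1,3) e]
    by simp
  finally show ?thesis by simp
qed

theorem two_category_vertical_two_cat: "two_category (vertical_two_cat K)"
proof -
  let ?V = "vertical_two_cat K"
  have [simp]: "obj ?V = obj K" "arr ?V = arr K" "src ?V = src K" "tgt ?V = tgt K"
    "idn ?V = idn K" "cmp ?V = cmp K" "id2 ?V = idv K" "par2 ?V = hcomp K"
    "\<And>\<psi> \<phi>. obj2 ?V \<psi> \<phi> = vcomp K \<psi> [\<phi>]"
    by (simp_all add: vertical_two_cat_def)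
  have [simp]: "arr_in ?V f a b \<longleftrightarrow> arr_in K f a b" for f a b
    by (simp add: arr_in_def)
  have [simp]: "cell2_in ?V \<phi> f g \<longleftrightarrow> cell_in K \<phi> [] [] f g" for \<phi> f g
    unfolding cell2_in_def cell_in_def by (auto simp: vertical_two_cat_def)
  show ?thesis
  proof (unfold_locales, simp_all)
    fix f assume "f \<in> arr K"
    then show "src K f \<in> obj K" "tgt K f \<in> obj K" "cell_in K (idv K f) [] [] f f"
      using src_obj tgt_obj idv_in by auto
  next
    fix a assume "a \<in> obj K" then show "arr_in K (idn K a) a a" by (rule idn_in)
  next
    fix f a b h c assume "arr_in K f a b" "arr_in K h b c"
    then show "arr_in K (cmp K h f) a c" by (rule cmp_in)
  next
    fix f a b assume "arr_in K f a b"
    then show "cmp K (idn K b) f = f" "cmp K f (idn K a) = f"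
      by (rule cmp_idn_left, rule cmp_idn_right)
  next
    fix f a b g c h d assume "arr_in K f a b" "arr_in K g b c" "arr_in K h c d"
    then show "cmp K h (cmp K g f) = cmp K (cmp K h g) f" by (rule cmp_assoc)
  next
    fix \<alpha> f g assume 1: "cell_in K \<alpha> [] [] f g"
    then show "f \<in> arr K \<and> g \<in> arr K \<and> src K f = src K g \<and> tgt K f = tgt K g"
      using cell_in_arr cell_in_ends by metis
    then have f: "f \<in> arr K" "g \<in> arr K" "tgt K f = tgt K g" "tgt K f \<in> obj K"
      using tgt_obj by auto
    note i = idn_cell[OF f(4)]
    show "hcomp K (idv K f) \<alpha> = \<alpha>" "hcomp K \<alpha> (idv K g) = \<alpha>"
      using vcomp_idv_pair(2,3)[OF i 1] idn_vcomp[OF 1 refl] arr_idn f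
        hcomp_eq[OF idv_in[OF f(1)] 1 refl] hcomp_eq[OF 1 idv_in[OF f(2)] refl] by simp_all
    show "vcomp K (idv K (idn K (tgt K f))) [\<alpha>] = \<alpha>"
      "vcomp K \<alpha> [idv K (idn K (src K f))] = \<alpha>"
      using idn_vcomp[OF 1 refl] vcomp_idn[OF 1 refl] by auto
  next
    fix \<alpha> \<beta> f g h assume "cell_in K \<alpha> [] [] f g" "cell_in K \<beta> [] [] g h"
    then show "cell_in K (hcomp K \<alpha> \<beta>) [] [] f h" using hcomp_in by fastforce
  next
    fix \<alpha> f g \<beta> h \<gamma> k
    assume "cell_in K \<alpha> [] [] f g" "cell_in K \<beta> [] [] g h" "cell_in K \<gamma> [] [] h k"
    then show "hcomp K (hcomp K \<alpha> \<beta>) \<gamma> = hcomp K \<alpha> (hcomp K \<beta> \<gamma>)"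
      by (rule hcomp_assoc)
  next
    fix \<alpha> f g \<beta> h k
    assume "cell_in K \<alpha> [] [] f g" "cell_in K \<beta> [] [] h k" "tgt K f = src K h"
    then show "cell_in K (vcomp K \<beta> [\<alpha>]) [] [] (cmp K h f) (cmp K k g)"
      using vcomp1_in by blast
  next
    fix \<alpha> f f' \<beta> g g' \<gamma> h h'
    assume "cell_in K \<alpha> [] [] f f'" "cell_in K \<beta> [] [] g g'" "cell_in K \<gamma> [] [] h h'"
      "tgt K f = src K g" "tgt K g = src K h"
    then show "vcomp K \<gamma> [vcomp K \<beta> [\<alpha>]] = vcomp K (vcomp K \<gamma> [\<beta>]) [\<alpha>]"
      using vcomp_assoc11 by blast
  next
    fix f h assume "f \<in> arr K" "h \<in> arr K" "tgt K f = src K h"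
    then show "vcomp K (idv K h) [idv K f] = idv K (cmp K h f)" using vcomp_idv_idv by simp
  next
    fix \<alpha> f f' \<alpha>' f'' \<beta> h h' \<beta>' h''
    assume "cell_in K \<alpha> [] [] f f'" "cell_in K \<alpha>' [] [] f' f''"
      "cell_in K \<beta> [] [] h h'" "cell_in K \<beta>' [] [] h' h''" "tgt K f = src K h"
    then show "vcomp K (hcomp K \<beta> \<beta>') [hcomp K \<alpha> \<alpha>']
        = hcomp K (vcomp K \<beta> [\<alpha>]) (vcomp K \<beta>' [\<alpha>'])"
      by (rule hcomp_interchange)
  qed
qed

lemma companion_unit_ex1:
  assumes "companion K f J \<epsilon>"
  shows "\<exists>!\<eta>. companion_unit K f J \<epsilon> \<eta>"
proof -
  have f: "f \<in> arr K" and \<epsilon>: "cell_in K \<epsilon> [J] [] f (idn K (tgt K f))" and c: "cartesian K \<epsilon>"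
    using assms unfolding companion_def by auto
  have a: "src K f \<in> obj K" "tgt K f \<in> obj K" using f src_obj tgt_obj by auto
  have b: "hsrc K \<epsilon> = [J]" "htgt K \<epsilon> = []" "vsrc K \<epsilon> = f" "vtgt K \<epsilon> = idn K (tgt K f)"
    using \<epsilon> unfolding cell_in_def by auto
  have "cell_in K (idv K f) [] [] (cmp K f (idn K (src K f))) (cmp K (idn K (tgt K f)) f)"
    using idv_in[OF f] cmp_idn[OF f] by simp
  then have "\<exists>!\<eta>. cell_in K \<eta> [] [J] (idn K (src K f)) f \<and> idv K f = vcomp K \<epsilon> [\<eta>]"
    using c[unfolded cartesian_def b, THEN conjunct2, THEN conjunct2, rule_format,
        of "idn K (src K f)" f "idv K f" "[]"] f arr_idn[OF a(1)] arr_idn[OF a(2)] by simp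
  then show ?thesis unfolding companion_unit_def by (simp only: eq_commute[of "idv K f"])
qed

lemma companion_identities:
  assumes comp: "companion K f J \<epsilon>" and unit: "companion_unit K f J \<epsilon> \<eta>"
  shows "vcomp K \<epsilon> [\<eta>] = idv K f" "hcomp K \<eta> \<epsilon> = idh K J"
proof -
  show \<epsilon>\<eta>: "vcomp K \<epsilon> [\<eta>] = idv K f" using unit unfolding companion_unit_def by simp
  let ?a = "src K f" and ?c = "tgt K f"
  have f: "f \<in> arr K" and J: "J \<in> hmor K" "hdom K J = ?a" "hcod K J = ?c"
    and \<epsilon>: "cell_in K \<epsilon> [J] [] f (idn K ?c)" and c: "cartesian K \<epsilon>"
    using comp unfolding companion_def by auto
  have \<eta>: "cell_in K \<eta> [] [J] (idn K ?a) f" using unit unfolding companion_unit_def by simp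
  have a: "?a \<in> obj K" "?c \<in> obj K" using f src_obj tgt_obj by auto
  note i = arr_idn[OF a(1)] arr_idn[OF a(2)]
  have b: "hsrc K \<epsilon> = [J]" "htgt K \<epsilon> = []" "vsrc K \<epsilon> = f" "vtgt K \<epsilon> = idn K ?c"
    using \<epsilon> unfolding cell_in_def by auto
  have idJ: "cell_in K (idh K J) [J] [J] (idn K ?a) (idn K ?c)" using idh_in J by metis
  have h: "hcomp K \<eta> \<epsilon> = vcomp K (idh K J) [\<eta>, \<epsilon>]" by (rule hcomp_eq_idh[OF \<eta> \<epsilon>]) simp
  have hin: "cell_in K (hcomp K \<eta> \<epsilon>) [J] [J] (idn K ?a) (idn K ?c)"
    using vcomp2_in[of "idh K J" "[J]" "[]" "[J]" "idn K ?a" "idn K ?c", OF _ \<eta> \<epsilon>] idJ h i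
      cmp_idn[OF i(1)] cmp_idn[OF i(4)] by simp
  have "vcomp K \<epsilon> [hcomp K \<eta> \<epsilon>] = vcomp K \<epsilon> [\<eta>, \<epsilon>]"
    unfolding h using vcomp_assoc12[of \<epsilon> "[J]" _ _ _ "idh K J" "[J]" "[]", OF \<epsilon> _ _ _ _ _] \<eta> \<epsilon> idJ i
      vcomp_idh[OF \<epsilon>] by simp
  also have "\<dots> = vcomp K (vcomp K (idv K (idn K ?c)) [\<epsilon>, idv K (idn K ?c)]) [\<eta>, \<epsilon>]"
    using vcomp_idv_pair(3)[OF idn_cell[OF a(2)] \<epsilon>] idn_vcomp[OF \<epsilon> refl] i by simp
  also have "\<dots> = vcomp K (idv K (idn K ?c)) [vcomp K \<epsilon> [\<eta>], vcomp K (idv K (idn K ?c)) [\<epsilon>]]"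
    using vcomp_assoc2[of "idv K (idn K ?c)" "[]" "[]" "[]" "idn K ?c" "idn K ?c",
        OF _ \<epsilon> idn_cell[OF a(2)] \<eta> \<epsilon>] idn_cell[OF a(2)] i by simp
  also have "\<dots> = \<epsilon>"
    using vcomp_idv_pair(2)[OF idn_cell[OF a(2)] \<epsilon>] idn_vcomp[OF \<epsilon> refl] i \<epsilon>\<eta> by simp
  finally have *: "vcomp K \<epsilon> [hcomp K \<eta> \<epsilon>] = \<epsilon>" .
  have "cell_in K \<epsilon> [J] [] (cmp K f (idn K ?a)) (cmp K (idn K ?c) (idn K ?c))"
    using \<epsilon> i cmp_idn(2)[OF f] cmp_idn(1)[OF i(4)] by simp
  then have "\<exists>!\<phi>. cell_in K \<phi> [J] (hsrc K \<epsilon>) (idn K ?a) (idn K ?c) \<and> \<epsilon> = vcomp K \<epsilon> [\<phi>]"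
    using c[unfolded cartesian_def b, THEN conjunct2, THEN conjunct2, rule_format,
        of "idn K ?a" "idn K ?c" \<epsilon> "[J]"] i unfolding b by simp
  then show "hcomp K \<eta> \<epsilon> = idh K J"
    using hin idJ * vcomp_idh[OF \<epsilon>] unfolding b by metis
qed

lemma companion_unit_weakly_cocartesian:
  assumes comp: "companion K f J \<epsilon>" and unit: "companion_unit K f J \<epsilon> \<eta>"
  shows "weakly_cocartesian K \<eta>"
proof -
  let ?a = "src K f" and ?c = "tgt K f"
  note ids = companion_identities[OF assms]
  have f: "f \<in> arr K" and J: "J \<in> hmor K" "hdom K J = ?a" "hcod K J = ?c"
    and \<epsilon>: "cell_in K \<epsilon> [J] [] f (idn K ?c)"
    using comp unfolding companion_def by auto
  have \<eta>: "cell_in K \<eta> [] [J] (idn K ?a) f" using unit unfolding companion_unit_def by simp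
  have a: "?a \<in> obj K" "?c \<in> obj K" using f src_obj tgt_obj by auto
  note i = arr_idn[OF a(1)] arr_idn[OF a(2)]
  have b: "hsrc K \<eta> = []" "htgt K \<eta> = [J]" "vsrc K \<eta> = idn K ?a" "vtgt K \<eta> = f" "\<eta> \<in> cell K"
    using \<eta> unfolding cell_in_def by auto
  have idJ: "cell_in K (idh K J) [J] [J] (idn K ?a) (idn K ?c)" using idh_in J by metis
  have h: "hcomp K \<eta> \<epsilon> = vcomp K (idh K J) [\<eta>, \<epsilon>]" by (rule hcomp_eq_idh[OF \<eta> \<epsilon>]) simp
  have "\<exists>!\<psi>. cell_in K \<psi> [J] Ks p q \<and> \<chi> = vcomp K \<psi> [\<eta>]"
    if pq: "p \<in> arr K" "q \<in> arr K" "src K p = ?a" "src K q = ?c"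
      and "cell_in K \<chi> [] Ks (cmp K p (idn K ?a)) (cmp K q f)" for \<chi> Ks p q
  proof -
    have \<chi>: "cell_in K \<chi> [] Ks p (cmp K q f)" using that cmp_idn[OF pq(1)] by simp
    have Q: "cell_in K (idv K q) [] [] q q" using idv_in pq by simp
    have w: "cell_in K (vcomp K (idv K q) [\<epsilon>]) [J] [] (cmp K q f) q"
      using vcomp1_in[OF Q \<epsilon>] pq cmp_idn[OF pq(2)] by simp
    have l: "length Ks \<le> 1" using \<chi> htgt_length unfolding cell_in_def by auto
    have KS: "hpath K (tgt K p) Ks (tgt K q)"
      using cell_in_arr(4)[OF \<chi>] arr_cmp(3)[OF f pq(2)] pq by simp
    define j where "j = idpath K (tgt K p) Ks"
    have tp: "tgt K p \<in> obj K" "tgt K q \<in> obj K" using pq tgt_obj by auto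
    have j: "cell_in K j Ks Ks (idn K (tgt K p)) (idn K (tgt K q))"
    proof (cases Ks)
      case Nil then show ?thesis using KS idn_cell[OF tp(1)] unfolding j_def by auto
    next
      case (Cons L Ls)
      then have "Ls = []" using l by simp
      then show ?thesis using Cons KS idh_in[of L] unfolding j_def by auto
    qed
    have jl: "vcomp K j [\<phi>] = \<phi>" if "cell_in K \<phi> Hs Ks r s" "tgt K r = tgt K p" for \<phi> Hs r s
    proof (cases Ks)
      case Nil then show ?thesis using that idn_vcomp unfolding j_def by (metis idpath.simps(1))
    next
      case (Cons L Ls)
      then have "Ls = []" using l by simp
      then show ?thesis using Cons that idh_vcomp unfolding j_def by (metis idpath.simps(2))
    qed
    have jc: "cell_in K j (Ks @ []) Ks (idn K (tgt K p)) (idn K (tgt K q))" using j by simp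
    have wit: "cell_in K (vcomp K j [\<chi>, vcomp K (idv K q) [\<epsilon>]]) [J] Ks p q"
      using vcomp2_in[OF jc \<chi> w] cmp_idn[OF pq(1)] cmp_idn[OF pq(2)] arr_idn tp
      by simp
    have qa: "src K (cmp K q f) = ?a" "tgt K (cmp K q f) = tgt K q" "cmp K q f \<in> arr K"
      using arr_cmp f pq by simp_all
    note Ia = idn_cell[OF a(1)]
    have qf: "cell_in K (idv K (cmp K q f)) [] [] (cmp K q f) (cmp K q f)"
      using idv_in qa by simp
    have \<chi>a: "vcomp K \<chi> [idv K (idn K ?a)] = \<chi>" using vcomp_idn[OF \<chi>] pq by simp
    have wit2: "vcomp K (vcomp K j [\<chi>, vcomp K (idv K q) [\<epsilon>]]) [\<eta>] = \<chi>"
    proof -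
      have "vcomp K (vcomp K j [\<chi>, vcomp K (idv K q) [\<epsilon>]]) [\<eta>]
          = vcomp K (vcomp K j [\<chi>, vcomp K (idv K q) [\<epsilon>]]) [idv K (idn K ?a), \<eta>]"
        using vcomp_idv_pair(2)[OF wit \<eta>] i pq by simp
      also have "\<dots> = vcomp K j [vcomp K \<chi> [idv K (idn K ?a)], vcomp K (vcomp K (idv K q) [\<epsilon>]) [\<eta>]]"
        using vcomp_assoc2[OF jc \<chi> w Ia \<eta>] i qa pq arr_idn tp by simp
      also have "vcomp K (vcomp K (idv K q) [\<epsilon>]) [\<eta>] = idv K (cmp K q f)"
        using vcomp_assoc11[OF Q \<epsilon> \<eta>] i pq ids vcomp_idv_idv[OF f pq(2)] by simp
      also have "vcomp K j [vcomp K \<chi> [idv K (idn K ?a)], idv K (cmp K q f)] = \<chi>"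
        unfolding \<chi>a using vcomp_idv_pair(3)[OF j \<chi>] jl[OF \<chi>] arr_idn tp by simp
      finally show ?thesis .
    qed
    have uniq: "\<psi> = vcomp K j [\<chi>, vcomp K (idv K q) [\<epsilon>]]"
      if \<psi>: "cell_in K \<psi> [J] Ks p q" and e: "\<chi> = vcomp K \<psi> [\<eta>]" for \<psi>
    proof -
      have idJ': "cell_in K (idh K J) ([J] @ []) [J] (idn K ?a) (idn K ?c)" using idJ by simp
      have "\<psi> = vcomp K \<psi> [hcomp K \<eta> \<epsilon>]" using vcomp_idh[OF \<psi>] ids by simp
      also have "\<dots> = vcomp K \<psi> [\<eta>, \<epsilon>]"
        unfolding h using vcomp_assoc12[OF \<psi> idJ' \<eta> \<epsilon>] i pq vcomp_idh[OF \<psi>] by simp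
      also have "\<dots> = vcomp K (vcomp K j [\<psi>, idv K q]) [\<eta>, \<epsilon>]"
        using vcomp_idv_pair(3)[OF j \<psi>] jl[OF \<psi>] arr_idn tp by simp
      also have "\<dots> = vcomp K j [vcomp K \<psi> [\<eta>], vcomp K (idv K q) [\<epsilon>]]"
        using vcomp_assoc2[OF jc \<psi> Q \<eta> \<epsilon>] i pq arr_idn tp by simp
      finally show ?thesis using e by simp
    qed
    show ?thesis
      by (rule ex1I[of _ "vcomp K j [\<chi>, vcomp K (idv K q) [\<epsilon>]]"]) (use wit wit2 uniq in auto)
  qed
  moreover have "tgt K (idn K ?a) = ?a" using i by simp
  ultimately show ?thesis unfolding weakly_cocartesian_def b using b(5) by auto
qed

end

end

theory Submission
  imports Defs
begin

text \<open>Both triangle composites can be rewritten in terms of the transposes, using only the companion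
  identities: \<open>(\<eta> \<circ> g) \<odot> (g \<circ> \<epsilon>) = \<eta>' \<circ> \<epsilon>'\<close> and
  \<open>(f \<circ> \<eta>) \<odot> (\<epsilon> \<circ> f) = \<epsilon>\<^sub>f \<circ> (\<eta>' \<odot> \<epsilon>') \<circ> \<eta>\<^sub>f\<close>. Hence one triangle identity is
  literally the first conjoint identity, and the other one is equivalent to the second because
  a cell \<open>\<phi> : J \<Rightarrow> J\<close> is determined by \<open>\<epsilon>\<^sub>f \<circ> \<phi> \<circ> \<eta>\<^sub>f\<close>. The conjoint identities
  make \<open>\<chi> \<mapsto> \<chi> \<odot> (\<epsilon>' \<circ> k)\<close> inverse to composition with \<open>\<eta>'\<close>.\<close>

context augmented_virtual_double_category
begin

section \<open>Whiskering and splitting composites with two cells\<close>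

text \<open>Inserting \<open>idv K f'\<close> after \<open>\<phi>\<close> lets associativity
  distribute over the pair; the cell \<open>\<beta>\<close>, whose horizontal source is empty, is
  only whiskered by \<open>f'\<close>.\<close>

lemma vcomp_idv_right:
  assumes "cell_in K \<xi> (Ks @ Ks') Ls p q"
    and "cell_in K \<alpha> Js Ks h k" and "cell_in K \<beta> [] Ks' k l"
    and "cell_in K \<phi> Hs Js f f'" and "tgt K f = src K h" and "tgt K h = src K p"
  shows "vcomp K (vcomp K \<xi> [\<alpha>, \<beta>]) [\<phi>] = vcomp K \<xi> [vcomp K \<alpha> [\<phi>], vcomp K \<beta> [idv K f']]"
proof -
  have f': "f' \<in> arr K" "tgt K f' = src K k"
    using cell_in_arr(2)[OF assms(4)] vcomp_idv_pair(1)[OF assms(2,4,5)] by simp_all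
  have \<xi>: "cell_in K (vcomp K \<xi> [\<alpha>, \<beta>]) Js Ls (cmp K p h) (cmp K q l)"
    using vcomp2_in[OF assms(1-3,6)] by simp
  have "tgt K f = src K (cmp K p h)"
    using arr_cmp(2)[OF cell_in_arr(1)[OF assms(2)] cell_in_arr(1)[OF assms(1)] assms(6)] assms(5)
    by simp
  then show ?thesis
    using vcomp_idv_pair(3)[OF \<xi> assms(4)]
      vcomp_assoc2[OF assms(1-4) idv_in[OF f'(1)] assms(5) f'(2) assms(6)] by simp
qed

text \<open>Mirror image: the identity of \<open>f\<close> is inserted before \<open>\<phi>\<close>
  and lands under \<open>\<alpha>\<close>.\<close>

lemma vcomp_idv_left:
  assumes "cell_in K \<xi> (Ks @ Ks') Ls p q"
    and "cell_in K \<alpha> [] Ks h k" and "cell_in K \<beta> Js Ks' k l"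
    and "cell_in K \<phi> Hs Js f f'" and "tgt K f = src K h" and "tgt K h = src K p"
  shows "vcomp K (vcomp K \<xi> [\<alpha>, \<beta>]) [\<phi>] = vcomp K \<xi> [vcomp K \<alpha> [idv K f], vcomp K \<beta> [\<phi>]]"
proof -
  have f: "f \<in> arr K" "tgt K f = src K k"
    using cell_in_arr(1)[OF assms(4)] cell_in_ends(1)[OF assms(2)] assms(5) by simp_all
  have \<xi>: "cell_in K (vcomp K \<xi> [\<alpha>, \<beta>]) Js Ls (cmp K p h) (cmp K q l)"
    using vcomp2_in[OF assms(1-3,6)] by simp
  have "tgt K f = src K (cmp K p h)"
    using arr_cmp(2)[OF cell_in_arr(1)[OF assms(2)] cell_in_arr(1)[OF assms(1)] assms(6)] assms(5)
    by simp
  then show ?thesis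
    using vcomp_idv_pair(2)[OF \<xi> assms(4)]
      vcomp_assoc2[OF assms(1-3) idv_in[OF f(1)] assms(4) assms(5) f(2) assms(6)] by simp
qed

text \<open>Since its horizontal target is empty, \<open>\<psi>\<close> equals
  \<open>\<psi> \<odot> id_k\<close>; associativity then composes \<open>\<phi>\<close> with
  \<open>\<psi>\<close> and \<open>\<theta>\<close> with \<open>id_k\<close>.\<close>

lemma vcomp_eq_hcomp_left:
  assumes \<psi>: "cell_in K \<psi> Ks [] h k" and \<phi>: "cell_in K \<phi> Js Ks f g"
    and \<theta>: "cell_in K \<theta> Hs [] g g'" and e: "tgt K f = src K h"
  shows "vcomp K \<psi> [\<phi>, \<theta>] = hcomp K (vcomp K \<psi> [\<phi>]) (vcomp K (idv K k) [\<theta>])"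
proof -
  let ?i = "idv K (idn K (tgt K h))"
  have a: "h \<in> arr K" "k \<in> arr K" "f \<in> arr K" "tgt K h \<in> obj K" "tgt K g = src K k"
    using cell_in_arr(1,2)[OF \<psi>] cell_in_arr(1)[OF \<phi>] tgt_obj vcomp_idv_pair(1)[OF \<psi> \<phi> e]
    by simp_all
  have k: "cell_in K (idv K k) [] [] k k" using idv_in a by simp
  have i: "cell_in K ?i ([] @ []) [] (idn K (tgt K h)) (idn K (tgt K h))"
    using idn_cell a by simp
  have "vcomp K \<psi> [\<phi>, \<theta>] = vcomp K (vcomp K ?i [\<psi>, idv K k]) [\<phi>, \<theta>]"
    using vcomp_idv_pair(3)[OF i[simplified] \<psi>] idn_vcomp[OF \<psi> refl] arr_idn(2) a by simp
  also have "\<dots> = vcomp K ?i [vcomp K \<psi> [\<phi>], vcomp K (idv K k) [\<theta>]]"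
    using vcomp_assoc2[OF i \<psi> k \<phi>] \<theta> arr_idn(2) a e by simp
  also have "\<dots> = hcomp K (vcomp K \<psi> [\<phi>]) (vcomp K (idv K k) [\<theta>])"
    using hcomp_eq[OF vcomp1_in[OF \<psi> \<phi> e] vcomp1_in[OF k \<theta> a(5)]] arr_cmp(3) a e by simp
  finally show ?thesis .
qed

text \<open>The same argument starting from \<open>\<psi> = id_h \<odot> \<psi>\<close>.\<close>

lemma vcomp_eq_hcomp_right:
  assumes \<psi>: "cell_in K \<psi> Ks [] h k" and \<theta>: "cell_in K \<theta> Hs [] f g"
    and \<phi>: "cell_in K \<phi> Js Ks g g'" and e: "tgt K f = src K h"
  shows "vcomp K \<psi> [\<theta>, \<phi>] = hcomp K (vcomp K (idv K h) [\<theta>]) (vcomp K \<psi> [\<phi>])"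
proof -
  let ?i = "idv K (idn K (tgt K h))"
  have a: "h \<in> arr K" "k \<in> arr K" "f \<in> arr K" "tgt K h \<in> obj K"
    using cell_in_arr(1,2)[OF \<psi>] cell_in_arr(1)[OF \<theta>] tgt_obj by simp_all
  have e': "tgt K g = src K h" using cell_in_ends(2)[OF \<theta>] e by simp
  have h: "cell_in K (idv K h) [] [] h h" using idv_in a by simp
  have i: "cell_in K ?i ([] @ []) [] (idn K (tgt K h)) (idn K (tgt K h))"
    using idn_cell a by simp
  have "vcomp K \<psi> [\<theta>, \<phi>] = vcomp K (vcomp K ?i [idv K h, \<psi>]) [\<theta>, \<phi>]"
    using vcomp_idv_pair(2)[OF i[simplified] \<psi>] idn_vcomp[OF \<psi> refl] arr_idn(2) a by simp
  also have "\<dots> = vcomp K ?i [vcomp K (idv K h) [\<theta>], vcomp K \<psi> [\<phi>]]"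
    using vcomp_assoc2[OF i h \<psi> \<theta> \<phi>] arr_idn(2) a e e' by simp
  also have "\<dots> = hcomp K (vcomp K (idv K h) [\<theta>]) (vcomp K \<psi> [\<phi>])"
    using hcomp_eq[OF vcomp1_in[OF h \<theta> e] vcomp1_in[OF \<psi> \<phi> e']] arr_cmp(3) a e by simp
  finally show ?thesis .
qed

section \<open>Endocells of a companion, and recognition of conjoints\<close>

text \<open>Two uniqueness properties combine: that of the companion unit gives
  \<open>\<phi> \<circ> \<eta> = \<eta>\<close>, and that of factorisations through the weakly
  cocartesian cell \<open>\<eta>\<close> then identifies \<open>\<phi>\<close>.\<close>

lemma companion_endo_eq_idh:
  assumes comp: "companion K f J \<epsilon>" and unit: "companion_unit K f J \<epsilon> \<eta>"
    and \<phi>: "cell_in K \<phi> [J] [J] (idn K (src K f)) (idn K (tgt K f))"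
    and eq: "vcomp K \<epsilon> [vcomp K \<phi> [\<eta>]] = idv K f"
  shows "\<phi> = idh K J"
proof -
  let ?a = "src K f" and ?c = "tgt K f"
  have f: "f \<in> arr K" "?a \<in> obj K" "?c \<in> obj K"
    and J: "J \<in> hmor K" "hdom K J = ?a" "hcod K J = ?c"
    using comp src_obj tgt_obj unfolding companion_def by auto
  note i = arr_idn[OF f(2)] arr_idn[OF f(3)]
  have c: "cmp K (idn K ?a) (idn K ?a) = idn K ?a" "cmp K (idn K ?c) f = f"
    using cmp_idn(1)[OF i(1)] cmp_idn(1)[OF f(1)] i by simp_all
  have \<eta>: "cell_in K \<eta> [] [J] (idn K ?a) f" using unit unfolding companion_unit_def by simp
  have "cell_in K (vcomp K \<phi> [\<eta>]) [] [J] (idn K ?a) f"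
    using vcomp1_in[OF \<phi> \<eta>] i c by simp
  then have "companion_unit K f J \<epsilon> (vcomp K \<phi> [\<eta>])"
    using eq unfolding companion_unit_def by simp
  then have \<phi>\<eta>: "vcomp K \<phi> [\<eta>] = \<eta>" using companion_unit_ex1[OF comp] unit by auto
  have b: "hsrc K \<eta> = []" "htgt K \<eta> = [J]" "vsrc K \<eta> = idn K ?a" "vtgt K \<eta> = f"
    using \<eta> unfolding cell_in_def by auto
  \<comment> \<open>The cell \<open>\<eta>\<close> is factored through itself; both
    \<open>\<phi>\<close> and \<open>idh K J\<close> are such factorisations.\<close>
  have "\<exists>!\<psi>. cell_in K \<psi> [J] [J] (idn K ?a) (idn K ?c) \<and> \<eta> = vcomp K \<psi> [\<eta>]"
    using companion_unit_weakly_cocartesian[OF comp unit,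
        unfolded weakly_cocartesian_def b, THEN conjunct2, THEN conjunct2, rule_format,
        of "idn K ?a" "idn K ?c" \<eta> "[J]"] \<eta> i c by simp
  moreover have "cell_in K (idh K J) [J] [J] (idn K ?a) (idn K ?c)"
    using idh_in[OF J(1)] J by simp
  ultimately show ?thesis using \<phi> \<phi>\<eta> idh_vcomp[OF \<eta>] by metis
qed

text \<open>The first identity shows that the explicit candidate is a factorisation through
  \<open>\<eta>'\<close>, the second that every factorisation equals it.\<close>

lemma conjointI:
  assumes g: "arr_in K g C A" and J: "J \<in> hmor K" "hdom K J = A" "hcod K J = C"
    and \<eta>': "cell_in K \<eta>' [J] [] (idn K A) g"
    and \<epsilon>': "cell_in K \<epsilon>' [] [J] g (idn K C)"
    and 1: "vcomp K \<eta>' [\<epsilon>'] = idv K g" and 2: "hcomp K \<eta>' \<epsilon>' = idh K J"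
  shows "conjoint K g J \<eta>'"
proof -
  have a: "g \<in> arr K" "src K g = C" "tgt K g = A" "A \<in> obj K" "C \<in> obj K"
    using g src_obj tgt_obj unfolding arr_in_def by auto
  note i = arr_idn[OF a(4)] arr_idn[OF a(5)]
  \<comment> \<open>The split \<open>[] @ [J]\<close> says that of two cells placed on top of
    \<open>idh K J\<close>, the second contributes \<open>J\<close>.\<close>
  have idJ: "cell_in K (idh K J) ([] @ [J]) [J] (idn K A) (idn K C)"
    using idh_in[OF J(1)] J by simp
  have h2: "vcomp K (idh K J) [\<eta>', \<epsilon>'] = idh K J"
    using hcomp_eq_idh[OF \<eta>' \<epsilon>'] 2 by simp
  have "\<exists>!\<phi>. cell_in K \<phi> Hs [J] h k \<and> \<chi> = vcomp K \<eta>' [\<phi>]"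
    if hk: "h \<in> arr K" "k \<in> arr K" "tgt K h = A" "tgt K k = C"
      and "cell_in K \<chi> Hs [] (cmp K (idn K A) h) (cmp K g k)" for \<chi> Hs h k
  proof -
    have c: "cmp K (idn K A) h = h" "cmp K (idn K C) k = k"
      using cmp_idn(1)[OF hk(1)] cmp_idn(1)[OF hk(2)] hk by simp_all
    have \<chi>: "cell_in K \<chi> Hs [] h (cmp K g k)" using that c by simp
    have k: "cell_in K (idv K k) [] [] k k" using idv_in hk by simp
    have w: "cell_in K (vcomp K \<epsilon>' [idv K k]) [] [J] (cmp K g k) k"
      using vcomp1_in[OF \<epsilon>' k] hk a c by simp
    \<comment> \<open>This is \<open>\<chi> \<odot> (\<epsilon>' \<circ> k)\<close>, with
      \<open>hcomp\<close> spelled out so that associativity applies directly.\<close>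
    let ?\<phi> = "vcomp K (idh K J) [\<chi>, vcomp K \<epsilon>' [idv K k]]"
    have "cell_in K ?\<phi> Hs [J] h k"
      using vcomp2_in[OF idJ \<chi> w] i hk c by simp
    moreover have "vcomp K \<eta>' [?\<phi>] = \<chi>"
    proof -
      have "vcomp K \<eta>' [?\<phi>] = vcomp K \<eta>' [\<chi>, vcomp K \<epsilon>' [idv K k]]"
        using vcomp_assoc12[OF \<eta>' idJ \<chi> w] vcomp_idh[OF \<eta>'] i hk by simp
      also have "\<dots> = hcomp K (vcomp K (idv K (idn K A)) [\<chi>]) (vcomp K \<eta>' [vcomp K \<epsilon>' [idv K k]])"
        using vcomp_eq_hcomp_right[OF \<eta>' \<chi> w] i hk by simp
      also have "vcomp K \<eta>' [vcomp K \<epsilon>' [idv K k]] = idv K (cmp K g k)"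
        using vcomp_assoc11[OF \<eta>' \<epsilon>' k] 1 vcomp_idv_idv a i hk by simp
      also have "vcomp K (idv K (idn K A)) [\<chi>] = \<chi>" using idn_vcomp[OF \<chi>] hk by simp
      also have "hcomp K \<chi> (idv K (cmp K g k)) = \<chi>"
        using hcomp_eq[OF \<chi> idv_in refl] vcomp_idv_pair(3)[OF idn_cell[OF a(4)] \<chi>]
          idn_vcomp[OF \<chi>] i a hk arr_cmp by simp
      finally show ?thesis .
    qed
    moreover have "\<phi> = ?\<phi>" if "cell_in K \<phi> Hs [J] h k" "\<chi> = vcomp K \<eta>' [\<phi>]" for \<phi>
    proof -
      \<comment> \<open>Whiskering the second conjoint identity: \<open>\<phi> = (\<eta>' \<odot>
        \<epsilon>') \<circ> \<phi> = (\<eta>' \<circ> \<phi>) \<odot> (\<epsilon>' \<circ>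
        k)\<close>.\<close>
      have "\<phi> = vcomp K (vcomp K (idh K J) [\<eta>', \<epsilon>']) [\<phi>]"
        using idh_vcomp[OF that(1)] h2 by simp
      also have "\<dots> = ?\<phi>"
        unfolding that(2) by (rule vcomp_idv_right[OF idJ \<eta>' \<epsilon>' that(1)]) (use hk i in simp_all)
      finally show ?thesis .
    qed
    ultimately show ?thesis by (intro ex1I[of _ ?\<phi>] conjI) (simp, simp, metis)
  qed
  moreover have "hsrc K \<eta>' = [J]" "htgt K \<eta>' = []" "vsrc K \<eta>' = idn K A" "vtgt K \<eta>' = g"
    "\<eta>' \<in> cell K"
    using \<eta>' unfolding cell_in_def by auto
  ultimately have "cartesian K \<eta>'" unfolding cartesian_def by (simp add: i a)
  then show ?thesis unfolding conjoint_def using a J \<eta>' by simp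
qed

section \<open>Triangle composites in terms of the transposes\<close>

text \<open>The companion identity \<open>\<eta>f \<odot> \<epsilon>f = id_J\<close> expands
  \<open>\<epsilon>'\<close> as \<open>(\<eta>f \<circ> g) \<odot> (\<epsilon>f \<circ>
  \<epsilon>')\<close>; composing with \<open>\<eta>'\<close> yields the triangle.\<close>

lemma triangle_right_transpose:
  assumes f: "arr_in K f A C" and g: "arr_in K g C A"
    and comp: "companion K f J \<epsilon>f" and unit: "companion_unit K f J \<epsilon>f \<eta>f"
    and \<eta>': "cell_in K \<eta>' [J] [] (idn K A) g"
    and \<epsilon>': "cell_in K \<epsilon>' [] [J] g (idn K C)"
  shows "hcomp K (vcomp K (vcomp K \<eta>' [\<eta>f]) [idv K g]) (vcomp K (idv K g) [vcomp K \<epsilon>f [\<epsilon>']])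
    = vcomp K \<eta>' [\<epsilon>']"
proof -
  have a: "f \<in> arr K" "src K f = A" "tgt K f = C" "g \<in> arr K" "src K g = C" "tgt K g = A"
      "A \<in> obj K" "C \<in> obj K"
    using f g src_obj tgt_obj unfolding arr_in_def by auto
  note i = arr_idn[OF a(7)] arr_idn[OF a(8)]
  have c: "cmp K (idn K A) g = g" "cmp K (idn K C) (idn K C) = idn K C"
    using cmp_idn(1)[OF a(4)] cmp_idn(1)[OF i(4)] a i by simp_all
  have J: "J \<in> hmor K" "hdom K J = A" "hcod K J = C"
    and \<epsilon>f: "cell_in K \<epsilon>f [J] [] f (idn K C)" and \<eta>f: "cell_in K \<eta>f [] [J] (idn K A) f"
    using comp unit a unfolding companion_def companion_unit_def by auto
  \<comment> \<open>Here the first cell, \<open>\<eta>f\<close> or a whiskering of it, contributes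
    \<open>J\<close>.\<close>
  have idJ: "cell_in K (idh K J) ([J] @ []) [J] (idn K A) (idn K C)"
    using idh_in[OF J(1)] J by simp
  have ids: "vcomp K (idh K J) [\<eta>f, \<epsilon>f] = idh K J"
    using companion_identities(2)[OF comp unit] hcomp_eq_idh[OF \<eta>f \<epsilon>f] by simp
  have G: "cell_in K (idv K g) [] [] g g" using idv_in a by simp
  have p: "cell_in K (vcomp K \<eta>f [idv K g]) [] [J] g (cmp K f g)"
    using vcomp1_in[OF \<eta>f G] a i c by simp
  have q: "cell_in K (vcomp K \<epsilon>f [\<epsilon>']) [] [] (cmp K f g) (idn K C)"
    using vcomp1_in[OF \<epsilon>f \<epsilon>'] a c by simp
  have "vcomp K (idh K J) [vcomp K \<eta>f [idv K g], vcomp K \<epsilon>f [\<epsilon>']] = \<epsilon>'"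
    using vcomp_idv_left[OF idJ \<eta>f \<epsilon>f \<epsilon>'] ids idh_vcomp[OF \<epsilon>'] a i by simp
  then have "vcomp K \<eta>' [\<epsilon>'] = vcomp K \<eta>' [vcomp K \<eta>f [idv K g], vcomp K \<epsilon>f [\<epsilon>']]"
    using vcomp_assoc12[OF \<eta>' idJ p q] vcomp_idh[OF \<eta>'] a i by simp
  also have "\<dots> = hcomp K (vcomp K \<eta>' [vcomp K \<eta>f [idv K g]]) (vcomp K (idv K g) [vcomp K \<epsilon>f [\<epsilon>']])"
    using vcomp_eq_hcomp_left[OF \<eta>' p q] a i by simp
  also have "vcomp K \<eta>' [vcomp K \<eta>f [idv K g]] = vcomp K (vcomp K \<eta>' [\<eta>f]) [idv K g]"
    using vcomp_assoc11[OF \<eta>' \<eta>f G] a i by simp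
  finally show ?thesis by simp
qed

text \<open>Under \<open>\<epsilon>f\<close> the composite
  \<open>\<eta>' \<odot> \<epsilon>'\<close> splits as \<open>(f \<circ> \<eta>') \<odot>
  (\<epsilon>f \<circ> \<epsilon>')\<close>, and precomposing with \<open>\<eta>f\<close> turns the
  two factors into the whiskered unit and counit.\<close>

lemma triangle_left_transpose:
  assumes f: "arr_in K f A C" and g: "arr_in K g C A"
    and comp: "companion K f J \<epsilon>f" and unit: "companion_unit K f J \<epsilon>f \<eta>f"
    and \<eta>': "cell_in K \<eta>' [J] [] (idn K A) g"
    and \<epsilon>': "cell_in K \<epsilon>' [] [J] g (idn K C)"
  shows "hcomp K (vcomp K (idv K f) [vcomp K \<eta>' [\<eta>f]]) (vcomp K (vcomp K \<epsilon>f [\<epsilon>']) [idv K f])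
      = vcomp K \<epsilon>f [vcomp K (hcomp K \<eta>' \<epsilon>') [\<eta>f]]"
    and "cell_in K (hcomp K \<eta>' \<epsilon>') [J] [J] (idn K A) (idn K C)"
proof -
  have a: "f \<in> arr K" "src K f = A" "tgt K f = C" "g \<in> arr K" "src K g = C" "tgt K g = A"
      "A \<in> obj K" "C \<in> obj K"
    using f g src_obj tgt_obj unfolding arr_in_def by auto
  note i = arr_idn[OF a(7)] arr_idn[OF a(8)]
  have c: "cmp K f (idn K A) = f" "cmp K (idn K A) (idn K A) = idn K A"
    "cmp K (idn K C) (idn K C) = idn K C"
    using cmp_idn(2)[OF a(1)] cmp_idn(1)[OF i(1)] cmp_idn(1)[OF i(4)] a i by simp_all
  have J: "J \<in> hmor K" "hdom K J = A" "hcod K J = C"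
    and \<epsilon>f: "cell_in K \<epsilon>f [J] [] f (idn K C)" and \<eta>f: "cell_in K \<eta>f [] [J] (idn K A) f"
    using comp unit a unfolding companion_def companion_unit_def by auto
  have idJ: "cell_in K (idh K J) ([] @ [J]) [J] (idn K A) (idn K C)"
    using idh_in[OF J(1)] J by simp
  have h: "hcomp K \<eta>' \<epsilon>' = vcomp K (idh K J) [\<eta>', \<epsilon>']"
    using hcomp_eq_idh[OF \<eta>' \<epsilon>'] by simp
  show H: "cell_in K (hcomp K \<eta>' \<epsilon>') [J] [J] (idn K A) (idn K C)"
    unfolding h using vcomp2_in[OF idJ \<eta>' \<epsilon>'] i c by simp
  have F: "cell_in K (idv K f) [] [] f f" using idv_in a by simp
  have p: "cell_in K (vcomp K (idv K f) [\<eta>']) [J] [] f (cmp K f g)"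
    using vcomp1_in[OF F \<eta>'] a i c by simp
  have q: "cell_in K (vcomp K \<epsilon>f [\<epsilon>']) [] [] (cmp K f g) (idn K C)"
    using vcomp1_in[OF \<epsilon>f \<epsilon>'] a c by simp
  let ?i = "idv K (idn K C)"
  have I: "cell_in K ?i ([] @ []) [] (idn K C) (idn K C)" using idn_cell[OF a(8)] by simp
  have t: "tgt K (cmp K f g) = C" using arr_cmp(3)[OF a(4,1)] a by simp
  \<comment> \<open>The vertical target is bracketed as \<open>(f g) f\<close>, through
    \<open>p\<close>, to match the vertical source of \<open>q'\<close>.\<close>
  have p': "cell_in K (vcomp K (idv K f) [vcomp K \<eta>' [\<eta>f]]) [] [] f (cmp K (cmp K f g) f)"
    using vcomp1_in[OF p \<eta>f] vcomp_assoc11[OF F \<eta>' \<eta>f] a i c by simp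
  have q': "cell_in K (vcomp K (vcomp K \<epsilon>f [\<epsilon>']) [idv K f]) [] []
      (cmp K (cmp K f g) f) (cmp K (idn K C) f)"
    using vcomp1_in[OF q F] arr_cmp(2)[OF a(4,1)] a by simp
  have "vcomp K \<epsilon>f [vcomp K (hcomp K \<eta>' \<epsilon>') [\<eta>f]] = vcomp K (vcomp K \<epsilon>f [hcomp K \<eta>' \<epsilon>']) [\<eta>f]"
    using vcomp_assoc11[OF \<epsilon>f H \<eta>f] a i by simp
  also have "vcomp K \<epsilon>f [hcomp K \<eta>' \<epsilon>'] = vcomp K \<epsilon>f [\<eta>', \<epsilon>']"
    unfolding h using vcomp_assoc12[OF \<epsilon>f idJ \<eta>' \<epsilon>'] vcomp_idh[OF \<epsilon>f] a i by simp
  also have "\<dots> = vcomp K ?i [vcomp K (idv K f) [\<eta>'], vcomp K \<epsilon>f [\<epsilon>']]"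
    using vcomp_eq_hcomp_right[OF \<epsilon>f \<eta>' \<epsilon>'] hcomp_eq[OF p q] a i by simp
  also have "vcomp K \<dots> [\<eta>f]
      = vcomp K ?i [vcomp K (vcomp K (idv K f) [\<eta>']) [\<eta>f], vcomp K (vcomp K \<epsilon>f [\<epsilon>']) [idv K f]]"
    using vcomp_idv_right[OF I p q \<eta>f] a i by simp
  also have "vcomp K (vcomp K (idv K f) [\<eta>']) [\<eta>f] = vcomp K (idv K f) [vcomp K \<eta>' [\<eta>f]]"
    using vcomp_assoc11[OF F \<eta>' \<eta>f] a i by simp
  finally show "hcomp K (vcomp K (idv K f) [vcomp K \<eta>' [\<eta>f]]) (vcomp K (vcomp K \<epsilon>f [\<epsilon>']) [idv K f])
      = vcomp K \<epsilon>f [vcomp K (hcomp K \<eta>' \<epsilon>') [\<eta>f]]"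
    using hcomp_eq[OF p' q'] a by simp
qed

section \<open>Equivalence of the triangle and conjoint identities\<close>

text \<open>Exposes the triangle identities in the operations of \<open>K\<close>, where the
  transposition equations can rewrite them.\<close>

lemma adjunction_in_vertical_two_cat_iff:
  "adjunction_in (vertical_two_cat K) f g \<eta> \<epsilon> \<longleftrightarrow>
    (\<exists>a c. arr_in K f a c \<and> arr_in K g c a \<and>
      cell_in K \<eta> [] [] (idn K a) (cmp K g f) \<and> cell_in K \<epsilon> [] [] (cmp K f g) (idn K c) \<and>
      hcomp K (vcomp K (idv K f) [\<eta>]) (vcomp K \<epsilon> [idv K f]) = idv K f \<and>
      hcomp K (vcomp K \<eta> [idv K g]) (vcomp K (idv K g) [\<epsilon>]) = idv K g)"
  unfolding adjunction_in_def arr_in_def cell2_in_def cell_in_def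
  by (simp add: vertical_two_cat_def conj_assoc)

end

theorem lemma5p16:
  fixes K :: "('o, 'v, 'h, 'c) avdc"
    and A C :: 'o and f g :: 'v and J :: 'h
    and \<epsilon>f \<eta>f \<eta> \<epsilon> \<eta>' \<epsilon>' :: 'c
  assumes "augmented_virtual_double_category K"
    and "arr_in K f A C"
    and "companion K f J \<epsilon>f"
    and "companion_unit K f J \<epsilon>f \<eta>f"
    and "arr_in K g C A"
    and "cell_in K \<eta> [] [] (idn K A) (cmp K g f)"
    and "cell_in K \<epsilon> [] [] (cmp K f g) (idn K C)"
    and "cell_in K \<eta>' [J] [] (idn K A) g"
    and "\<eta> = vcomp K \<eta>' [\<eta>f]"
    and "cell_in K \<epsilon>' [] [J] g (idn K C)"
    and "\<epsilon> = vcomp K \<epsilon>f [\<epsilon>']"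
  shows "(adjunction_in (vertical_two_cat K) f g \<eta> \<epsilon> \<longleftrightarrow>
            vcomp K \<eta>' [\<epsilon>'] = idv K g \<and> hcomp K \<eta>' \<epsilon>' = idh K J)
       \<and> (vcomp K \<eta>' [\<epsilon>'] = idv K g \<and> hcomp K \<eta>' \<epsilon>' = idh K J \<longrightarrow>
            conjoint K g J \<eta>')"
proof -
  interpret augmented_virtual_double_category K by fact
  note transposes = assms(2,5,3,4,8,10)
  note R = triangle_right_transpose[OF transposes]
    and L = triangle_left_transpose[OF transposes]
  have fAC: "src K f = A" "tgt K f = C" using assms(2) unfolding arr_in_def by auto
  have J: "J \<in> hmor K" "hdom K J = A" "hcod K J = C"
    using assms(3) fAC unfolding companion_def by auto
  have \<eta>f: "cell_in K \<eta>f [] [J] (idn K A) f" "vcomp K \<epsilon>f [\<eta>f] = idv K f"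
    using assms(4) fAC unfolding companion_unit_def by auto
  \<comment> \<open>Left to right is the recognition of endocells; conversely
    \<open>id_J \<circ> \<eta>f = \<eta>f\<close> and
    \<open>\<epsilon>f \<circ> \<eta>f = id_f\<close>.\<close>
  have "vcomp K \<epsilon>f [vcomp K (hcomp K \<eta>' \<epsilon>') [\<eta>f]] = idv K f \<longleftrightarrow> hcomp K \<eta>' \<epsilon>' = idh K J"
    using companion_endo_eq_idh[OF assms(3,4), of "hcomp K \<eta>' \<epsilon>'"] L(2) fAC
      idh_vcomp[OF \<eta>f(1)] \<eta>f(2) by metis
  then have "adjunction_in (vertical_two_cat K) f g \<eta> \<epsilon> \<longleftrightarrow>
      vcomp K \<eta>' [\<epsilon>'] = idv K g \<and> hcomp K \<eta>' \<epsilon>' = idh K J"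
    unfolding adjunction_in_vertical_two_cat_iff
    using assms(2,5,6,7) R[folded assms(9,11)] L(1)[folded assms(9,11)] by metis
  then show ?thesis using conjointI[OF assms(5) J assms(8,10)] by blast
qed

end
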